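(* Let $R$ be a partially ordered ring such that every order ideal of $R$ which is meet-irreducible as an order ideal is primary as an ideal (in particular, this hypothesis holds if $R$ is noetherian and every order ideal which is meet-irreducible as an order ideal is meet-irreducible as an ideal). Then $R$ satisfies order unit cancellation; that is, whenever $u \in R$ is an order unit of $R$ which is not a zero divisor, and $a \in R$ satisfies $ua \in R^+$, then $a \in R^+$.
   Context: A partially ordered ring $R$ is a commutative unital ring with a subset $R^+$ (the positive cone) making $R$ a partially ordered abelian group under addition ($r\ge s$ means $r-s\in R^+$), such that $R^+\cdot R^+ = R^+$, the group is unperforated (if $n$ is a positive integer, $g \in R$ and $ng\in R^+$, then $g\in R^+$), and $1$ is an order unit. An element $u$ of $R$ is an order unit if for every $g\in R$ there is a positive integer $M$ with $-Mu \le g \le Mu$. An order ideal of $R$ is a subgroup $I$ that is convex ($0\le g\le h$ with $h\in I$, $g\in R$ implies $g\in I$) and directed ($I$ is generated as a group by $I\cap R^+$); in a partially ordered ring (a commutative unital ring $R$ with positive cone $R^+$ satisfying $R^+\cdot R^+ = R^+$, unperforated, and with $1$ as an order unit) every order ideal is a ring ideal. A proper order ideal is meet-irreducible as an order ideal if it is not the intersection of two strictly larger order ideals; a proper ideal is meet-irreducible as an ideal if it is not the intersection of two strictly larger ideals. *)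

theory Defs
  imports "HOL-Algebra.Algebra"
begin

(* The order on R is the one determined by the positive cone P. *)
definition ring_le :: "('a, 'b) ring_scheme \<Rightarrow> 'a set \<Rightarrow> 'a \<Rightarrow> 'a \<Rightarrow> bool" where
  "ring_le R P s r \<longleftrightarrow> r \<ominus>\<^bsub>R\<^esub> s \<in> P"

definition order_unit :: "('a, 'b) ring_scheme \<Rightarrow> 'a set \<Rightarrow> 'a \<Rightarrow> bool" where
  "order_unit R P u \<longleftrightarrow> u \<in> carrier R \<and>
     (\<forall>g\<in>carrier R. \<exists>M::nat. 0 < M \<and>
        ring_le R P (\<ominus>\<^bsub>R\<^esub> ([M] \<cdot>\<^bsub>R\<^esub> u)) g \<and> ring_le R P g ([M] \<cdot>\<^bsub>R\<^esub> u))"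

(* The first four cone axioms say that ring_le R P is a translation-invariant partial
   order on the carrier.  The zero ring is not excluded. *)
locale partially_ordered_ring = cring R for R (structure) +
  fixes P :: "'a set"
  assumes cone_subset: "P \<subseteq> carrier R"
    and zero_in_cone: "\<zero> \<in> P"
    and cone_add_closed: "\<lbrakk>a \<in> P; b \<in> P\<rbrakk> \<Longrightarrow> a \<oplus> b \<in> P"
    and cone_antisym: "\<lbrakk>a \<in> P; \<ominus> a \<in> P\<rbrakk> \<Longrightarrow> a = \<zero>"
    and cone_mult: "P <#> P = P"
    and unperforated: "\<lbrakk>0 < (n::nat); g \<in> carrier R; [n] \<cdot> g \<in> P\<rbrakk> \<Longrightarrow> g \<in> P"
    and one_order_unit: "order_unit R P \<one>"

definition order_ideal :: "('a, 'b) ring_scheme \<Rightarrow> 'a set \<Rightarrow> 'a set \<Rightarrow> bool" where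
  "order_ideal R P I \<longleftrightarrow> additive_subgroup I R \<and>
     (\<forall>g\<in>carrier R. \<forall>h\<in>I. ring_le R P \<zero>\<^bsub>R\<^esub> g \<and> ring_le R P g h \<longrightarrow> g \<in> I) \<and>
     generate (add_monoid R) (I \<inter> P) = I"

(* The intersection of two order ideals need not be an order ideal: J \<inter> K below is the
   plain set intersection. *)
definition meet_irreducible_order_ideal ::
    "('a, 'b) ring_scheme \<Rightarrow> 'a set \<Rightarrow> 'a set \<Rightarrow> bool" where
  "meet_irreducible_order_ideal R P I \<longleftrightarrow> order_ideal R P I \<and> I \<noteq> carrier R \<and>
     \<not> (\<exists>J K. order_ideal R P J \<and> order_ideal R P K \<and> I \<subset> J \<and> I \<subset> K \<and> I = J \<inter> K)"

definition meet_irreducible_ideal :: "('a, 'b) ring_scheme \<Rightarrow> 'a set \<Rightarrow> bool" where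
  "meet_irreducible_ideal R I \<longleftrightarrow> ideal I R \<and> I \<noteq> carrier R \<and>
     \<not> (\<exists>J K. ideal J R \<and> ideal K R \<and> I \<subset> J \<and> I \<subset> K \<and> I = J \<inter> K)"

definition primary_ideal :: "('a, 'b) ring_scheme \<Rightarrow> 'a set \<Rightarrow> bool" where
  "primary_ideal R I \<longleftrightarrow> ideal I R \<and> I \<noteq> carrier R \<and>
     (\<forall>a\<in>carrier R. \<forall>b\<in>carrier R. a \<otimes>\<^bsub>R\<^esub> b \<in> I \<longrightarrow>
        a \<in> I \<or> (\<exists>n::nat. 0 < n \<and> b [^]\<^bsub>R\<^esub> n \<in> I))"

definition zero_divisor :: "('a, 'b) ring_scheme \<Rightarrow> 'a \<Rightarrow> bool" where
  "zero_divisor R u \<longleftrightarrow> u \<in> carrier R \<and>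
     (\<exists>b\<in>carrier R. b \<noteq> \<zero>\<^bsub>R\<^esub> \<and> u \<otimes>\<^bsub>R\<^esub> b = \<zero>\<^bsub>R\<^esub>)"

definition order_unit_cancellation :: "('a, 'b) ring_scheme \<Rightarrow> 'a set \<Rightarrow> bool" where
  "order_unit_cancellation R P \<longleftrightarrow>
     (\<forall>u a. order_unit R P u \<and> \<not> zero_divisor R u \<and> a \<in> carrier R \<and> u \<otimes>\<^bsub>R\<^esub> a \<in> P
        \<longrightarrow> a \<in> P)"

end

theory Submission
  imports Defs
begin

text \<open>Let \<open>u\<close> be an order unit and \<open>w = ua \<ge> 0\<close>, and let \<open>I\<close> be the order ideal generated by \<open>w\<close>.
  If \<open>a \<notin> I\<close>, an order ideal that contains \<open>w\<close> and is maximal among those avoiding \<open>a\<close> is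
  meet-irreducible, hence primary; as it contains \<open>ua\<close> but not \<open>a\<close>, it contains a power of \<open>u\<close>, thus
  also \<open>1\<close> and \<open>a\<close>, a contradiction. So \<open>a \<ge> -Nw\<close> for some \<open>N\<close>.  Choose \<open>K\<close> with
  \<open>0 \<le> s = K - u \<le> K\<close>.  Iterating \<open>Ka = sa + w\<close> gives \<open>K^(n+1) a \<ge> K s^n a + n s^n w\<close>, and for
  \<open>n = KN\<close> the right-hand side is \<open>K s^n (a + Nw) \<ge> 0\<close>; unperforation then yields \<open>a \<ge> 0\<close>.\<close>

context partially_ordered_ring
begin

section \<open>Elementary facts on the cone and on order units\<close>

lemma cone_carrier: "x \<in> P \<Longrightarrow> x \<in> carrier R"
  using cone_subset by blast

lemma cone_mult_closed: "\<lbrakk>a \<in> P; b \<in> P\<rbrakk> \<Longrightarrow> a \<otimes> b \<in> P"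
  using cone_mult unfolding set_mult_def by blast

lemma cone_add_pow_closed: "x \<in> P \<Longrightarrow> [(n::nat)] \<cdot> x \<in> P"
  by (induction n) (auto simp: zero_in_cone cone_add_closed)

text \<open>The lower bound \<open>-Mu \<le> u\<close> says \<open>(M+1)u \<ge> 0\<close>, and
  unperforation removes the positive factor \<open>M+1\<close>.\<close>

lemma order_unit_in_cone:
  assumes "order_unit R P u"
  shows "u \<in> P"
proof -
  have u: "u \<in> carrier R"
    using assms by (simp add: order_unit_def)
  then obtain M :: nat where M: "ring_le R P (\<ominus> ([M] \<cdot> u)) u"
    using assms unfolding order_unit_def by blast
  have "u \<ominus> \<ominus> ([M] \<cdot> u) = [Suc M] \<cdot> u"
    using u by (simp add: minus_eq add.nat_pow_Suc a_comm)
  then have "[Suc M] \<cdot> u \<in> P"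
    using M by (simp add: ring_le_def)
  then show ?thesis
    using unperforated u by blast
qed

lemma one_in_cone: "\<one> \<in> P"
  using order_unit_in_cone one_order_unit .

lemma cone_pow_closed: "x \<in> P \<Longrightarrow> x [^] (n::nat) \<in> P"
  by (induction n) (auto simp: one_in_cone cone_mult_closed)

lemma order_unit_multiple_ge:
  assumes "order_unit R P u" "g \<in> carrier R"
  obtains M :: nat where "0 < M" "[M] \<cdot> u \<ominus> g \<in> P"
  using assms unfolding order_unit_def ring_le_def by blast

text \<open>Turns integer multiples into ring products, so that the \<open>algebra\<close> method
  can handle the integer as an ordinary ring element.\<close>

lemma nat_mult_eq: "x \<in> carrier R \<Longrightarrow> ([(n::nat)] \<cdot> \<one>) \<otimes> x = [n] \<cdot> x"
  by (simp add: add_pow_ldistr)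

section \<open>Cancelling \<open>u\<close> when \<open>a\<close> is bounded below by a multiple of
  \<open>u \<otimes> a\<close>\<close>

lemma cone_cancel_nat_pow:
  assumes "0 < (K::nat)" "a \<in> carrier R" "(([K] \<cdot> \<one>) [^] (n::nat)) \<otimes> a \<in> P"
  shows "a \<in> P"
  using assms(3)
proof (induction n)
  case 0
  then show ?case using assms(2) by simp
next
  case (Suc n)
  let ?x = "(([K] \<cdot> \<one>) [^] n) \<otimes> a"
  have "(([K] \<cdot> \<one>) [^] Suc n) \<otimes> a = ([K] \<cdot> \<one>) \<otimes> ?x"
    using assms(2) by (simp add: m_ac)
  also have "\<dots> = [K] \<cdot> ?x"
    using assms(2) by (intro nat_mult_eq) simp
  finally have "[K] \<cdot> ?x \<in> P"
    using Suc.prems by simp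
  then have "?x \<in> P"
    using unperforated[OF assms(1)] assms(2) by simp
  then show ?case by (rule Suc.IH)
qed

text \<open>Write \<open>s = k - u\<close> and let \<open>D n\<close> be the difference claimed to
  be nonnegative. Expanding \<open>k = s + u\<close> gives
  \<open>D (n+1) = k D n + (n+1) s^n u (ua)\<close>, where all factors \<open>k\<close>,
  \<open>s\<close>, \<open>u\<close>, \<open>ua\<close> lie in the cone.\<close>

lemma cone_power_estimate:
  assumes u: "u \<in> P" and k: "k \<in> carrier R" and s: "k \<ominus> u \<in> P"
    and a: "a \<in> carrier R" and w: "u \<otimes> a \<in> P"
  shows "k [^] Suc n \<otimes> a
    \<ominus> (k \<otimes> (k \<ominus> u) [^] n \<otimes> a \<oplus> ([n] \<cdot> \<one>) \<otimes> (k \<ominus> u) [^] n \<otimes> (u \<otimes> a)) \<in> P"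
proof (induction n)
  case 0
  have "k [^] Suc 0 \<otimes> a
      \<ominus> (k \<otimes> (k \<ominus> u) [^] (0::nat) \<otimes> a \<oplus> ([(0::nat)] \<cdot> \<one>) \<otimes> (k \<ominus> u) [^] (0::nat) \<otimes> (u \<otimes> a)) = \<zero>"
    using k a cone_carrier[OF u] cone_carrier[OF w] by (simp add: r_neg minus_eq)
  then show ?case by (metis zero_in_cone)
next
  case (Suc n)
  have uc: "u \<in> carrier R" using u by (rule cone_carrier)
  define t where "t = (k \<ominus> u) [^] n"
  define c where "c = k [^] Suc n"
  define m where "m = [n] \<cdot> \<one>"
  have carr: "t \<in> carrier R" "c \<in> carrier R" "m \<in> carrier R"
    using k uc by (simp_all add: t_def c_def m_def)
  \<comment> \<open>Nonnegativity of \<open>k\<close> is what allows the induction hypothesis to be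
    multiplied by it.\<close>
  have "k = (k \<ominus> u) \<oplus> u"
    using k uc by algebra
  then have kP: "k \<in> P"
    using cone_add_closed[OF s u] by simp
  have IH: "c \<otimes> a \<ominus> (k \<otimes> t \<otimes> a \<oplus> m \<otimes> t \<otimes> (u \<otimes> a)) \<in> P"
    using Suc.IH by (simp only: t_def c_def m_def)
  have tP: "t \<in> P" and mP: "m \<oplus> \<one> \<in> P"
    using s one_in_cone by (simp_all add: t_def m_def cone_pow_closed cone_add_pow_closed cone_add_closed)
  have "k \<otimes> (c \<otimes> a \<ominus> (k \<otimes> t \<otimes> a \<oplus> m \<otimes> t \<otimes> (u \<otimes> a)))
      \<oplus> (m \<oplus> \<one>) \<otimes> (t \<otimes> (u \<otimes> (u \<otimes> a))) \<in> P"
    using cone_mult_closed[OF kP IH] cone_mult_closed[OF mP cone_mult_closed[OF tP cone_mult_closed[OF u w]]]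
    by (rule cone_add_closed)
  also have "k \<otimes> (c \<otimes> a \<ominus> (k \<otimes> t \<otimes> a \<oplus> m \<otimes> t \<otimes> (u \<otimes> a)))
      \<oplus> (m \<oplus> \<one>) \<otimes> (t \<otimes> (u \<otimes> (u \<otimes> a)))
    = (c \<otimes> k) \<otimes> a \<ominus> (k \<otimes> (t \<otimes> (k \<ominus> u)) \<otimes> a \<oplus> (m \<oplus> \<one>) \<otimes> (t \<otimes> (k \<ominus> u)) \<otimes> (u \<otimes> a))"
    using carr k uc a by algebra
  finally show ?case
    by (simp add: t_def c_def m_def)
qed

lemma cone_cancel_bounded:
  assumes u: "u \<in> P" and a: "a \<in> carrier R" and w: "u \<otimes> a \<in> P"
    and N: "a \<oplus> [(N::nat)] \<cdot> (u \<otimes> a) \<in> P"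
  shows "a \<in> P"
proof -
  have uc: "u \<in> carrier R" using u by (rule cone_carrier)
  obtain K :: nat where K: "0 < K" "[K] \<cdot> \<one> \<ominus> u \<in> P"
    using order_unit_multiple_ge[OF one_order_unit uc] .
  define k where "k = [K] \<cdot> \<one>"
  define v where "v = [N] \<cdot> \<one>"
  \<comment> \<open>The exponent \<open>K * N\<close> turns the coefficient \<open>[n]\<close> of
    the estimate into \<open>k \<otimes> v\<close>, so that \<open>k \<otimes> t\<close> becomes a
    common factor of both subtracted terms.\<close>
  define t where "t = (k \<ominus> u) [^] (K * N)"
  define c where "c = k [^] Suc (K * N)"
  have carr: "k \<in> carrier R" "v \<in> carrier R" "t \<in> carrier R" "c \<in> carrier R"
    using uc by (simp_all add: k_def v_def t_def c_def)
  have "[(K * N)] \<cdot> \<one> = k \<otimes> v"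
    by (simp add: k_def v_def nat_mult_eq add.nat_pow_pow mult.commute)
  moreover have "k \<ominus> u \<in> P"
    using K by (simp add: k_def)
  ultimately have est: "c \<otimes> a \<ominus> (k \<otimes> t \<otimes> a \<oplus> (k \<otimes> v) \<otimes> t \<otimes> (u \<otimes> a)) \<in> P"
    using cone_power_estimate[OF u carr(1) _ a w, of "K * N"] by (simp only: t_def c_def)
  have aP: "a \<oplus> v \<otimes> (u \<otimes> a) \<in> P"
    using N uc a by (simp add: v_def nat_mult_eq)
  have kP: "k \<in> P" and tP: "t \<in> P"
    using K one_in_cone by (simp_all add: k_def t_def cone_pow_closed cone_add_pow_closed)
  have "c \<otimes> a \<ominus> (k \<otimes> t \<otimes> a \<oplus> (k \<otimes> v) \<otimes> t \<otimes> (u \<otimes> a))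
      \<oplus> k \<otimes> t \<otimes> (a \<oplus> v \<otimes> (u \<otimes> a)) \<in> P"
    using est cone_mult_closed[OF cone_mult_closed[OF kP tP] aP] by (rule cone_add_closed)
  also have "c \<otimes> a \<ominus> (k \<otimes> t \<otimes> a \<oplus> (k \<otimes> v) \<otimes> t \<otimes> (u \<otimes> a))
      \<oplus> k \<otimes> t \<otimes> (a \<oplus> v \<otimes> (u \<otimes> a)) = c \<otimes> a"
    using carr uc a by algebra
  \<comment> \<open>\<open>c\<close> is a power of the integer \<open>K\<close> viewed in the ring,
    so unperforation can strip its factors one at a time.\<close>
  finally show ?thesis
    unfolding c_def k_def by (rule cone_cancel_nat_pow[OF K(1) a])
qed

section \<open>Order ideals: criterion, generation by one element, chains and maximality\<close>

lemma order_idealI: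
  assumes sub: "I \<subseteq> carrier R" and zero: "\<zero> \<in> I"
    and add: "\<And>x y. \<lbrakk>x \<in> I; y \<in> I\<rbrakk> \<Longrightarrow> x \<oplus> y \<in> I"
    and inv: "\<And>x. x \<in> I \<Longrightarrow> \<ominus> x \<in> I"
    and conv: "\<And>g h. \<lbrakk>h \<in> I; g \<in> P; h \<ominus> g \<in> P\<rbrakk> \<Longrightarrow> g \<in> I"
    and dir: "\<And>x. x \<in> I \<Longrightarrow> x \<in> generate (add_monoid R) (I \<inter> P)"
  shows "order_ideal R P I"
proof -
  have "subgroup I (add_monoid R)"
    using add zero inv sub by (intro subgroup.intro) (auto simp: a_inv_def)
  \<comment> \<open>Directedness is an equality of sets; \<open>dir\<close> supplies one inclusion,
    and this one holds in any subgroup.\<close>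
  moreover from this have "generate (add_monoid R) (I \<inter> P) \<subseteq> I"
    by (intro add.generate_subgroup_incl) auto
  ultimately show ?thesis
    using conv dir unfolding order_ideal_def ring_le_def
    by (auto simp: minus_eq intro!: additive_subgroupI)
qed

lemma order_ideal_convex:
  assumes "order_ideal R P I" "h \<in> I" "g \<in> P" "h \<ominus> g \<in> P"
  shows "g \<in> I"
  using assms cone_carrier[of g] unfolding order_ideal_def ring_le_def
  by (auto simp: minus_eq)

text \<open>The set consists of all \<open>x\<close> with \<open>-Nw \<le> x \<le> Nw\<close> for
  some \<open>N\<close>, and is the order ideal generated by \<open>w\<close>. It is directed
  because \<open>x = (x + Nw) - Nw\<close> is a difference of two of its nonnegative
  elements.\<close>

lemma order_ideal_interval:
  assumes w: "w \<in> P"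
  shows "order_ideal R P {x \<in> carrier R. \<exists>N::nat. [N] \<cdot> w \<ominus> x \<in> P \<and> x \<oplus> [N] \<cdot> w \<in> P}"
    (is "order_ideal R P ?I")
proof (rule order_idealI)
  have wc [simp]: "w \<in> carrier R"
    using w by (rule cone_carrier)
  show "?I \<subseteq> carrier R" by blast
  show "\<zero> \<in> ?I"
    using zero_in_cone by (auto simp: minus_eq intro!: exI[of _ 0])
  show "x \<oplus> y \<in> ?I" if "x \<in> ?I" "y \<in> ?I" for x y
  proof -
    obtain N M :: nat where x: "x \<in> carrier R" "[N] \<cdot> w \<ominus> x \<in> P" "x \<oplus> [N] \<cdot> w \<in> P"
      and y: "y \<in> carrier R" "[M] \<cdot> w \<ominus> y \<in> P" "y \<oplus> [M] \<cdot> w \<in> P"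
      using \<open>x \<in> ?I\<close> \<open>y \<in> ?I\<close> by blast
    have sum: "[(N + M)] \<cdot> w = [N] \<cdot> w \<oplus> [M] \<cdot> w"
      by (simp add: add.nat_pow_mult)
    have carr: "[N] \<cdot> w \<in> carrier R" "[M] \<cdot> w \<in> carrier R" by simp_all
    have "[(N + M)] \<cdot> w \<ominus> (x \<oplus> y) = ([N] \<cdot> w \<ominus> x) \<oplus> ([M] \<cdot> w \<ominus> y)"
      "x \<oplus> y \<oplus> [(N + M)] \<cdot> w = (x \<oplus> [N] \<cdot> w) \<oplus> (y \<oplus> [M] \<cdot> w)"
      unfolding sum using carr x(1) y(1) by algebra+
    then show ?thesis
      using x y cone_add_closed by (auto intro!: exI[of _ "N + M"])
  qed
  show "\<ominus> x \<in> ?I" if "x \<in> ?I" for x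
  proof -
    obtain N :: nat where x: "x \<in> carrier R" "[N] \<cdot> w \<ominus> x \<in> P" "x \<oplus> [N] \<cdot> w \<in> P"
      using \<open>x \<in> ?I\<close> by blast
    have carr: "[N] \<cdot> w \<in> carrier R" by simp
    have "[N] \<cdot> w \<ominus> \<ominus> x = x \<oplus> [N] \<cdot> w" "\<ominus> x \<oplus> [N] \<cdot> w = [N] \<cdot> w \<ominus> x"
      using carr x(1) by algebra+
    then show ?thesis
      using x by (auto intro!: exI[of _ N])
  qed
  show "g \<in> ?I" if "h \<in> ?I" "g \<in> P" "h \<ominus> g \<in> P" for g h
  proof -
    obtain N :: nat where h: "h \<in> carrier R" "[N] \<cdot> w \<ominus> h \<in> P"
      using \<open>h \<in> ?I\<close> by blast
    have carr: "[N] \<cdot> w \<in> carrier R" "g \<in> carrier R"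
      using \<open>g \<in> P\<close> cone_carrier by simp_all
    have "[N] \<cdot> w \<ominus> g = ([N] \<cdot> w \<ominus> h) \<oplus> (h \<ominus> g)"
      using carr h(1) by algebra
    then have "[N] \<cdot> w \<ominus> g \<in> P" "g \<oplus> [N] \<cdot> w \<in> P"
      using h that w cone_add_closed cone_add_pow_closed by simp_all
    then show ?thesis
      using carr by blast
  qed
  show "x \<in> generate (add_monoid R) (?I \<inter> P)" if x: "x \<in> ?I" for x
  proof -
    obtain N :: nat where x: "x \<in> carrier R" "[N] \<cdot> w \<ominus> x \<in> P" "x \<oplus> [N] \<cdot> w \<in> P"
      using \<open>x \<in> ?I\<close> by blast
    let ?v = "[N] \<cdot> w"
    have v: "?v \<in> P" "?v \<in> carrier R"
      using w by (simp_all add: cone_add_pow_closed)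
    \<comment> \<open>The shifted element \<open>x + Nw\<close> lies between \<open>0\<close> and
      \<open>2Nw\<close>, so its membership needs the witness \<open>N + N\<close>; for
      \<open>Nw\<close> itself the witness \<open>N\<close> suffices.\<close>
    have "[(N + N)] \<cdot> w = ?v \<oplus> ?v"
      by (simp add: add.nat_pow_mult)
    moreover have "?v \<oplus> ?v \<ominus> (x \<oplus> ?v) = ?v \<ominus> x"
      using v x(1) by algebra
    moreover have "?v \<ominus> ?v \<in> P"
      using v zero_in_cone by (simp add: minus_eq r_neg)
    moreover have "x \<oplus> ?v \<oplus> (?v \<oplus> ?v) \<in> P" "?v \<oplus> ?v \<in> P"
      using v x(3) by (simp_all add: cone_add_closed)
    ultimately have "x \<oplus> ?v \<in> ?I" "?v \<in> ?I"
      using x v zero_in_cone by (auto intro: exI[of _ "N + N"] exI[of _ N])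
    then have "(x \<oplus> ?v) \<oplus> \<ominus> ?v \<in> generate (add_monoid R) (?I \<inter> P)"
      using generate.eng[of "x \<oplus> ?v" "add_monoid R" "?I \<inter> P" "\<ominus> ?v"] v x(3)
        generate.incl[of "x \<oplus> ?v" "?I \<inter> P" "add_monoid R"]
        generate.inv[of "?v" "?I \<inter> P" "add_monoid R"]
      by (simp add: a_inv_def)
    moreover have "(x \<oplus> ?v) \<oplus> \<ominus> ?v = x"
      using v x(1) by algebra
    ultimately show ?thesis by simp
  qed
qed

text \<open>Provides upper bounds for Zorn's lemma. Any two elements lie in a common member of the
  chain, and generators found inside one member remain available in the union.\<close>

lemma order_ideal_Union_chain:
  assumes "C \<noteq> {}" "subset.chain {I. order_ideal R P I} C"
  shows "order_ideal R P (\<Union>C)"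
proof (rule order_idealI)
  have oi: "order_ideal R P I" if "I \<in> C" for I
    using assms(2) that by (auto simp: subset_chain_def)
  then have asg: "additive_subgroup I R" if "I \<in> C" for I
    using that by (simp add: order_ideal_def)
  show "\<Union>C \<subseteq> carrier R"
    using additive_subgroup.a_subset[OF asg] by blast
  show "\<zero> \<in> \<Union>C"
    using assms(1) additive_subgroup.zero_closed[OF asg] by blast
  show "x \<oplus> y \<in> \<Union>C" if "x \<in> \<Union>C" "y \<in> \<Union>C" for x y
  proof -
    obtain I J where "I \<in> C" "J \<in> C" "x \<in> I" "y \<in> J"
      using \<open>x \<in> \<Union>C\<close> \<open>y \<in> \<Union>C\<close> by blast
    moreover have "I \<subseteq> J \<or> J \<subseteq> I"
      using assms(2) calculation by (auto simp: subset_chain_def)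
    ultimately obtain L where "L \<in> C" "x \<in> L" "y \<in> L"
      by blast
    then show ?thesis
      using additive_subgroup.a_closed[OF asg] by blast
  qed
  show "\<ominus> x \<in> \<Union>C" if "x \<in> \<Union>C" for x
    using that additive_subgroup.a_inv_closed[OF asg] by blast
  show "g \<in> \<Union>C" if "h \<in> \<Union>C" "g \<in> P" "h \<ominus> g \<in> P" for g h
    using that order_ideal_convex[OF oi] by blast
  show "x \<in> generate (add_monoid R) (\<Union>C \<inter> P)" if "x \<in> \<Union>C" for x
  proof -
    obtain I where I: "I \<in> C" "x \<in> I"
      using \<open>x \<in> \<Union>C\<close> by blast
    then have "x \<in> generate (add_monoid R) (I \<inter> P)"
      using oi[OF I(1)] by (simp add: order_ideal_def)
    moreover have "generate (add_monoid R) (I \<inter> P) \<subseteq> generate (add_monoid R) (\<Union>C \<inter> P)"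
      using I(1) by (intro add.mono_generate) blast
    ultimately show ?thesis by blast
  qed
qed

text \<open>Zorn's lemma yields \<open>J\<close> maximal among the order ideals that contain
  \<open>I\<close> and avoid \<open>a\<close>. Every strictly larger order ideal then contains
  \<open>a\<close>, hence so does the intersection of any two of them, which therefore differs from
  \<open>J\<close>.\<close>

lemma meet_irreducible_order_ideal_avoiding:
  assumes I: "order_ideal R P I" and a: "a \<in> carrier R" "a \<notin> I"
  obtains J where "meet_irreducible_order_ideal R P J" "I \<subseteq> J" "a \<notin> J"
proof -
  define A where "A = {J. order_ideal R P J \<and> I \<subseteq> J \<and> a \<notin> J}"
  have "\<Union>C \<in> A" if "C \<noteq> {}" "subset.chain A C" for C
  proof -
    have "subset.chain {I. order_ideal R P I} C"
      using that by (auto simp: A_def subset_chain_def)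
    then show ?thesis
      using that order_ideal_Union_chain[of C] by (auto simp: A_def subset_chain_def)
  qed
  moreover have "A \<noteq> {}"
    using I a by (auto simp: A_def)
  ultimately obtain J where J: "J \<in> A" "\<forall>Y\<in>A. J \<subseteq> Y \<longrightarrow> Y = J"
    using subset_Zorn_nonempty[of A] by blast
  have "a \<in> Y" if "order_ideal R P Y" "J \<subset> Y" for Y
    using that J by (auto simp: A_def)
  then have "meet_irreducible_order_ideal R P J"
    using J(1) a(1) unfolding A_def meet_irreducible_order_ideal_def by blast
  then show thesis
    using that J(1) by (auto simp: A_def)
qed

text \<open>Some multiple \<open>m = Mu\<close> satisfies \<open>m \<ge> 1\<close>, and then all its
  powers do, by \<open>m^(i+1) - 1 = (m^i - 1) m + (m - 1)\<close>. Since \<open>m^n\<close> is a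
  ring multiple of \<open>u^n\<close>, it lies in \<open>J\<close>, and convexity applies to
  \<open>0 \<le> 1 \<le> m^n\<close>.\<close>

lemma one_in_order_ideal_if_order_unit_pow:
  assumes J: "order_ideal R P J" "ideal J R" and u: "order_unit R P u" and n: "u [^] (n::nat) \<in> J"
  shows "\<one> \<in> J"
proof -
  have uc: "u \<in> carrier R"
    using u by (simp add: order_unit_def)
  obtain M :: nat where M: "[M] \<cdot> u \<ominus> \<one> \<in> P"
    using order_unit_multiple_ge[OF u one_closed] .
  define m where "m = [M] \<cdot> u"
  have m: "m \<in> P" "m \<in> carrier R" "m \<ominus> \<one> \<in> P"
    using M uc order_unit_in_cone[OF u] by (simp_all add: m_def cone_add_pow_closed)
  have "m [^] i \<ominus> \<one> \<in> P" for i :: nat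
  proof (induction i)
    case 0
    show ?case by (simp add: minus_eq r_neg zero_in_cone)
  next
    case (Suc i)
    have ic: "m [^] i \<in> carrier R"
      using m by simp
    have "(m [^] i \<ominus> \<one>) \<otimes> m \<oplus> (m \<ominus> \<one>) \<in> P"
      using Suc m by (intro cone_add_closed cone_mult_closed)
    also have "(m [^] i \<ominus> \<one>) \<otimes> m \<oplus> (m \<ominus> \<one>) = m [^] i \<otimes> m \<ominus> \<one>"
      using ic m(2) by algebra
    finally show ?case by simp
  qed
  moreover have "m [^] n = ([M] \<cdot> \<one>) [^] n \<otimes> u [^] n"
    using uc nat_pow_distrib[of "[M] \<cdot> \<one>" u n] by (simp add: m_def nat_mult_eq)
  then have "m [^] n \<in> J"
    using ideal.I_l_closed[OF J(2) n] by simp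
  ultimately show ?thesis
    using order_ideal_convex[OF J(1) _ one_in_cone] by blast
qed

section \<open>Order unit cancellation from primary order ideals\<close>

lemma order_unit_cancellation_if_primary:
  assumes "\<And>I. meet_irreducible_order_ideal R P I \<Longrightarrow> primary_ideal R I"
  shows "order_unit_cancellation R P"
  unfolding order_unit_cancellation_def
proof (intro allI impI)
  fix u a
  assume "order_unit R P u \<and> \<not> zero_divisor R u \<and> a \<in> carrier R \<and> u \<otimes> a \<in> P"
  then have u: "order_unit R P u" and a: "a \<in> carrier R" and w: "u \<otimes> a \<in> P"
    by auto
  have uc: "u \<in> carrier R"
    using u by (simp add: order_unit_def)
  define I where
    "I = {x \<in> carrier R. \<exists>N::nat. [N] \<cdot> (u \<otimes> a) \<ominus> x \<in> P \<and> x \<oplus> [N] \<cdot> (u \<otimes> a) \<in> P}"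
  have I: "order_ideal R P I"
    unfolding I_def using w by (rule order_ideal_interval)
  have "u \<otimes> a \<in> I"
    using uc a w zero_in_cone cone_add_closed
    by (auto simp: I_def minus_eq r_neg intro!: exI[of _ 1])
  have "a \<in> I"
  proof (rule ccontr)
    assume "a \<notin> I"
    then obtain J where J: "meet_irreducible_order_ideal R P J" "I \<subseteq> J" "a \<notin> J"
      using meet_irreducible_order_ideal_avoiding[OF I a] by blast
    have prim: "primary_ideal R J"
      using assms J(1) .
    then have ideal: "ideal J R"
      by (simp add: primary_ideal_def)
    \<comment> \<open>The factors are swapped because \<open>primary_ideal\<close> puts a power of
      the second factor into the ideal, and that factor has to be \<open>u\<close>.\<close>
    have "a \<otimes> u \<in> J"
      using J(2) \<open>u \<otimes> a \<in> I\<close> a uc by (auto simp: m_comm)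
    then obtain n :: nat where "u [^] n \<in> J"
      using prim a uc J(3) unfolding primary_ideal_def by blast
    then have "\<one> \<in> J"
      using one_in_order_ideal_if_order_unit_pow[OF _ ideal u] J(1)
      by (simp add: meet_irreducible_order_ideal_def)
    then show False
      using ideal.I_l_closed[OF ideal _ a] a J(3) by fastforce
  qed
  \<comment> \<open>Membership in \<open>I\<close> supplies the bound
    \<open>a + N(ua) \<ge> 0\<close>.\<close>
  then show "a \<in> P"
    using cone_cancel_bounded[OF order_unit_in_cone[OF u] a w] by (auto simp: I_def)
qed

end

section \<open>Noetherian rings: meet-irreducible ideals are primary\<close>

lemma (in noetherian_ring) incseq_ideal_stabilizes:
  assumes "\<And>n::nat. ideal (I n) R" and "mono I"
  obtains n where "0 < n" "I (Suc n) = I n"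
proof -
  have "subset.chain {J. ideal J R} (range I)"
    using assms(1) monoD[OF assms(2)] nat_le_linear by (simp add: subset_chain_def image_subset_iff) blast
  then have "\<Union>(range I) \<in> range I"
    by (intro ideal_chain_is_trivial) auto
  then obtain n where n: "\<Union>(range I) = I n"
    by blast
  \<comment> \<open>The index \<open>n\<close> may be \<open>0\<close>, whereas the exponent in
    \<open>primary_ideal\<close> must be positive; hence stability is read off at
    \<open>Suc n\<close>.\<close>
  have "I (Suc n) \<subseteq> I n" "I (Suc (Suc n)) \<subseteq> I n"
    using n by blast+
  moreover have "I n \<subseteq> I (Suc n)" "I (Suc n) \<subseteq> I (Suc (Suc n))"
    using monoD[OF assms(2)] by simp_all
  ultimately have "I (Suc (Suc n)) = I (Suc n)"
    by blast
  then show thesis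
    using that by blast
qed

text \<open>This is the colon ideal \<open>(I : b)\<close>, the annihilator of the class of
  \<open>b\<close> modulo \<open>I\<close>. Taken for the powers of an element, it gives the
  ascending chain in the noetherian argument.\<close>

lemma (in cring) ideal_colon:
  assumes "ideal I R" "b \<in> carrier R"
  shows "ideal {r \<in> carrier R. r \<otimes> b \<in> I} R"
proof -
  interpret ideal I R by fact
  have "r \<otimes> x \<otimes> b \<in> I" "x \<otimes> r \<otimes> b \<in> I"
    if "r \<in> carrier R" "r \<otimes> b \<in> I" "x \<in> carrier R" for r x
  proof -
    have "x \<otimes> (r \<otimes> b) = r \<otimes> x \<otimes> b" "x \<otimes> (r \<otimes> b) = x \<otimes> r \<otimes> b"
      using that assms(2) by algebra+
    then show "r \<otimes> x \<otimes> b \<in> I" "x \<otimes> r \<otimes> b \<in> I"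
      using I_l_closed[OF that(2,3)] by simp_all
  qed
  then show ?thesis
    using assms(2)
    by (intro idealI subgroup.intro)
      (auto simp: ring_axioms l_distr l_minus a_closed a_inv_closed simp flip: a_inv_def)
qed

lemma (in cring) mem_add_cgenideal:
  assumes "ideal I R" "b \<in> carrier R"
  shows "x \<in> I <+>\<^bsub>R\<^esub> PIdl b \<longleftrightarrow> (\<exists>i\<in>I. \<exists>r\<in>carrier R. x = i \<oplus> r \<otimes> b)"
  by (auto simp: set_add_def' cgenideal_def)

lemma (in cring) ideal_add_cgenideal:
  assumes "ideal I R" "b \<in> carrier R"
  shows "ideal (I <+>\<^bsub>R\<^esub> PIdl b) R" "I \<subseteq> I <+>\<^bsub>R\<^esub> PIdl b" "b \<in> I <+>\<^bsub>R\<^esub> PIdl b"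
proof -
  interpret ideal I R by fact
  show "ideal (I <+>\<^bsub>R\<^esub> PIdl b) R"
    using add_ideals[OF assms(1) cgenideal_ideal[OF assms(2)]] .
  have "x = x \<oplus> \<zero> \<otimes> b" if "x \<in> I" for x
    using that assms(2) Icarr by simp
  then show "I \<subseteq> I <+>\<^bsub>R\<^esub> PIdl b"
    using mem_add_cgenideal[OF assms] by blast
  have "b = \<zero> \<oplus> \<one> \<otimes> b"
    using assms(2) by simp
  then show "b \<in> I <+>\<^bsub>R\<^esub> PIdl b"
    using mem_add_cgenideal[OF assms] zero_closed by blast
qed

text \<open>Noether's argument: for \<open>ab\<close> in \<open>I\<close>, choose
  \<open>n > 0\<close> at which the chain of the \<open>(I : b^n)\<close> is stationary. Then
  \<open>I\<close> is the intersection of \<open>I + (a)\<close> and \<open>I + (b^n)\<close>, so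
  irreducibility makes one of these equal to \<open>I\<close>.\<close>

lemma primary_ideal_if_meet_irreducible:
  fixes R (structure)
  assumes "cring R" "noetherian_ring R" and irr: "meet_irreducible_ideal R I"
  shows "primary_ideal R I"
proof -
  interpret cring R by fact
  interpret noetherian_ring R by fact
  have I: "ideal I R" "I \<noteq> carrier R"
    using irr by (simp_all add: meet_irreducible_ideal_def)
  interpret ideal I R by fact
  have "a \<in> I \<or> (\<exists>n::nat. 0 < n \<and> b [^] n \<in> I)"
    if a: "a \<in> carrier R" and b: "b \<in> carrier R" and ab: "a \<otimes> b \<in> I" for a b
  proof -
    define Q where "Q n = {r \<in> carrier R. r \<otimes> b [^] n \<in> I}" for n :: nat
    have "Q n \<subseteq> Q (Suc n)" for n
    proof
      fix r assume r: "r \<in> Q n"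
      then have "(r \<otimes> b [^] n) \<otimes> b \<in> I"
        using I_r_closed b by (simp add: Q_def)
      then show "r \<in> Q (Suc n)"
        using r b by (simp add: Q_def m_assoc)
    qed
    then have "mono Q"
      by (simp add: mono_iff_le_Suc)
    moreover have "ideal (Q n) R" for n
      unfolding Q_def using I(1) b by (intro ideal_colon) simp_all
    ultimately obtain n where n: "0 < n" "Q (Suc n) = Q n"
      using incseq_ideal_stabilizes by blast
    let ?c = "b [^] n"
    have c: "?c \<in> carrier R"
      using b by simp
    let ?J = "I <+>\<^bsub>R\<^esub> PIdl a" and ?K = "I <+>\<^bsub>R\<^esub> PIdl ?c"
    have "z \<in> I" if "z \<in> ?J" "z \<in> ?K" for z
    proof -
      obtain i r where z1: "z = i \<oplus> r \<otimes> a" "i \<in> I" "r \<in> carrier R"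
        using \<open>z \<in> ?J\<close> mem_add_cgenideal[OF I(1) a] by blast
      obtain j q where z2: "z = j \<oplus> q \<otimes> ?c" "j \<in> I" "q \<in> carrier R"
        using \<open>z \<in> ?K\<close> mem_add_cgenideal[OF I(1) c] by blast
      have carr: "i \<in> carrier R" "j \<in> carrier R"
        using z1 z2 Icarr by simp_all
      \<comment> \<open>Multiplication by \<open>b\<close> sends \<open>I + (a)\<close> into
        \<open>I\<close>. On the other side \<open>zb\<close> is congruent to
        \<open>q b^(n+1)\<close> modulo \<open>I\<close>, so stationarity brings
        \<open>q b^n\<close>, and with it \<open>z\<close>, into \<open>I\<close>.\<close>
      have "z \<otimes> b = i \<otimes> b \<oplus> r \<otimes> (a \<otimes> b)"
        using z1(1,3) a b carr by algebra
      then have "z \<otimes> b \<in> I"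
        using z1 b ab I_l_closed I_r_closed a_closed by simp
      then have "z \<otimes> b \<oplus> \<ominus> (j \<otimes> b) \<in> I"
        using z2(2) b I_r_closed a_closed a_inv_closed by simp
      moreover have "z \<otimes> b \<oplus> \<ominus> (j \<otimes> b) = q \<otimes> (?c \<otimes> b)"
        using z2(1,3) b c carr by algebra
      ultimately have "q \<in> Q (Suc n)"
        using z2(3) by (simp add: Q_def)
      then have "q \<otimes> ?c \<in> I"
        unfolding n(2) by (simp add: Q_def)
      then show ?thesis
        using z2 a_closed by simp
    qed
    then have "I = ?J \<inter> ?K"
      using ideal_add_cgenideal(2)[OF I(1) a] ideal_add_cgenideal(2)[OF I(1) c] by blast
    then have "I = ?J \<or> I = ?K"
      using irr ideal_add_cgenideal(1,2)[OF I(1) a] ideal_add_cgenideal(1,2)[OF I(1) c]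
      unfolding meet_irreducible_ideal_def by blast
    then show ?thesis
      using ideal_add_cgenideal(3)[OF I(1) a] ideal_add_cgenideal(3)[OF I(1) c] n(1) by blast
  qed
  then show ?thesis
    using I by (simp add: primary_ideal_def)
qed

theorem proposition6:
  fixes R :: "('a, 'b) ring_scheme" and P :: "'a set"
  assumes "partially_ordered_ring R P"
  shows "((\<forall>I. meet_irreducible_order_ideal R P I \<longrightarrow> primary_ideal R I)
            \<longrightarrow> order_unit_cancellation R P) \<and>
         (noetherian_ring R \<and>
          (\<forall>I. meet_irreducible_order_ideal R P I \<longrightarrow> meet_irreducible_ideal R I)
            \<longrightarrow> (\<forall>I. meet_irreducible_order_ideal R P I \<longrightarrow> primary_ideal R I))"
proof -
  interpret partially_ordered_ring R P by fact
  show ?thesis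
    using order_unit_cancellation_if_primary primary_ideal_if_meet_irreducible[OF is_cring] by blast
qed

end
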